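(* Let $r\ge 2$ and let $G$ be a finite $(r+1)$-partite $r$-graph with vertex classes $V_1,\ldots,V_{r+1}$ in which every partite $(r-1)$-tuple of vertices has strictly balanced degree. If $\max_j\sum_{i\ne j}\rho(i)>r-1$, then $G$ contains a copy of $K_{r+1}^r$.
   Context: An $r$-graph is an $r$-uniform hypergraph (here unweighted). It is $(r+1)$-partite with classes $V_1,\ldots,V_{r+1}$ if every edge has at most one vertex in each class. $P_i$ is the $r$-partite $r$-graph induced by the classes $V_j$, $j\ne i$, and $\rho(i)=|E(P_i)|/\prod_{j\ne i}|V_j|$. A set of vertices is partite if it has at most one vertex in each class. For a partite $(r-1)$-tuple $g$ and a class $V_i$ not meeting $g$, $d(V_i,g)$ is the number of vertices $v\in V_i$ such that $g\cup\{v\}$ is an edge of $G$. The tuple $g$ has strictly balanced degree if $d(V_i,g)=d(V_j,g)$ for the two classes $V_i,V_j$ not meeting $g$. $K_{r+1}^r$ is the complete $r$-graph on $r+1$ vertices. *)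

theory Defs
  imports Complex_Main "HOL-Library.Disjoint_Sets"
begin

definition uniform_hypergraph :: "nat \<Rightarrow> 'a set \<Rightarrow> 'a set set \<Rightarrow> bool" where
  "uniform_hypergraph r X E \<longleftrightarrow> (\<forall>e\<in>E. e \<subseteq> X \<and> card e = r)"

definition partite_set :: "'i set \<Rightarrow> ('i \<Rightarrow> 'a set) \<Rightarrow> 'a set \<Rightarrow> bool" where
  "partite_set I V g \<longleftrightarrow> g \<subseteq> (\<Union>i\<in>I. V i) \<and> (\<forall>i\<in>I. card (g \<inter> V i) \<le> 1)"

text \<open>A finite \<open>r\<close>-graph on the disjoint union of the finite classes \<open>V i\<close>, \<open>i \<in> I\<close>.
  Classes may be empty.\<close>

definition partite_hypergraph ::
    "nat \<Rightarrow> 'i set \<Rightarrow> ('i \<Rightarrow> 'a set) \<Rightarrow> 'a set set \<Rightarrow> bool" where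
  "partite_hypergraph r I V E \<longleftrightarrow>
     (\<forall>i\<in>I. finite (V i)) \<and> disjoint_family_on V I \<and>
     uniform_hypergraph r (\<Union>i\<in>I. V i) E \<and> (\<forall>e\<in>E. partite_set I V e)"

definition induced_edges :: "'a set set \<Rightarrow> 'a set \<Rightarrow> 'a set set" where
  "induced_edges E X = {e \<in> E. e \<subseteq> X}"

text \<open>The density \<open>\<rho>(i)\<close> of the subhypergraph induced by all classes other than \<open>V i\<close>.
  If one of those classes is empty, it is \<open>0\<close>, as division by zero yields zero.\<close>

definition class_density ::
    "'i set \<Rightarrow> ('i \<Rightarrow> 'a set) \<Rightarrow> 'a set set \<Rightarrow> 'i \<Rightarrow> real" where
  "class_density I V E i =
     real (card (induced_edges E (\<Union>j\<in>I - {i}. V j))) / (\<Prod>j\<in>I - {i}. real (card (V j)))"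

definition degree_into :: "'a set set \<Rightarrow> 'a set \<Rightarrow> 'a set \<Rightarrow> nat" where
  "degree_into E W g = card {v \<in> W. g \<union> {v} \<in> E}"

text \<open>When \<open>I\<close> has \<open>r + 1\<close> elements and \<open>g\<close> is a partite \<open>(r - 1)\<close>-set, exactly two classes
  do not meet \<open>g\<close>, so \<open>i\<close> and \<open>j\<close> below range over those two.\<close>

definition strictly_balanced_degree ::
    "'i set \<Rightarrow> ('i \<Rightarrow> 'a set) \<Rightarrow> 'a set set \<Rightarrow> 'a set \<Rightarrow> bool" where
  "strictly_balanced_degree I V E g \<longleftrightarrow>
     (\<forall>i\<in>I. \<forall>j\<in>I. V i \<inter> g = {} \<and> V j \<inter> g = {} \<longrightarrow>
        degree_into E (V i) g = degree_into E (V j) g)"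

definition complete_edges :: "nat \<Rightarrow> 'b set \<Rightarrow> 'b set set" where
  "complete_edges r A = {e. e \<subseteq> A \<and> card e = r}"

text \<open>The hypergraph with vertices \<open>X\<close> and edges \<open>E\<close> has a, not necessarily induced,
  subhypergraph isomorphic to the one with vertices \<open>Y\<close> and edges \<open>F\<close>.\<close>

definition contains_copy ::
    "'a set \<Rightarrow> 'a set set \<Rightarrow> 'b set \<Rightarrow> 'b set set \<Rightarrow> bool" where
  "contains_copy X E Y F \<longleftrightarrow>
     (\<exists>f. inj_on f Y \<and> f ` Y \<subseteq> X \<and> (\<forall>e\<in>F. f ` e \<in> E))"

end

theory Submission
  imports Defs "HOL-Analysis.Convex"
begin

text \<open>
  Write \<open>n\<^sub>i\<close> for the size of \<open>V i\<close>, and sum degrees over the \<open>(r - 1)\<close>-tuples missing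
  two classes: since degrees are balanced, all the \<open>P\<^sub>i\<close> have the same number \<open>m\<close> of edges.
  Fix \<open>j\<close>. If there is no copy of \<open>K\<^sub>r\<^sub>+\<^sub>1\<close>, then for every edge \<open>e\<close> of \<open>P\<^sub>j\<close> each vertex of \<open>V j\<close>
  extends at most \<open>r - 1\<close> of the \<open>r\<close> tuples \<open>e - V i\<close>, so the degrees of these tuples into \<open>V j\<close>
  add up to at most \<open>(r - 1) n\<^sub>j\<close>. Summed over all \<open>e\<close>, the \<open>i\<close>-th of these degrees contributes the
  sum of \<open>d(V i, g) d(V j, g) = d(V i, g)\<^sup>2\<close> over the tuples \<open>g\<close> missing \<open>V i\<close> and \<open>V j\<close>, which by
  Cauchy-Schwarz is at least \<open>m\<^sup>2 / (\<Prod>k\<noteq>i,j. n\<^sub>k) = m n\<^sub>j \<rho>(i)\<close>.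
  Hence \<open>m n\<^sub>j (\<Sum>i\<noteq>j. \<rho>(i)) \<le> m n\<^sub>j (r - 1)\<close>.
\<close>

section \<open>Transversals of a family of disjoint classes\<close>

definition transversals :: "'i set \<Rightarrow> ('i \<Rightarrow> 'a set) \<Rightarrow> 'a set set" where
  "transversals S V = {g. partite_set S V g \<and> card g = card S}"

text \<open>The intersections of \<open>g\<close> with the classes have size at most 1 and their
  sizes add up to \<open>card S\<close>, so none of them is empty.\<close>

lemma transversal_meets_class:
  assumes S: "finite S" "\<And>i. i \<in> S \<Longrightarrow> finite (V i)" "disjoint_family_on V S"
    and g: "g \<in> transversals S V" and k: "k \<in> S"
  shows "card (g \<inter> V k) = 1"
proof (rule ccontr)
  assume neq: "card (g \<inter> V k) \<noteq> 1"
  have le: "\<And>i. i \<in> S \<Longrightarrow> card (g \<inter> V i) \<le> 1" and sub: "g \<subseteq> (\<Union>i\<in>S. V i)"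
    and cg: "card g = card S"
    using g unfolding transversals_def partite_set_def by auto
  have "card g = card (\<Union>i\<in>S. g \<inter> V i)"
    using sub by (intro arg_cong[where f = card]) auto
  also have "\<dots> = (\<Sum>i\<in>S. card (g \<inter> V i))"
    using S by (intro card_UN_disjoint) (auto simp: disjoint_family_on_def)
  also have "\<dots> < (\<Sum>i\<in>S. 1)"
  proof (intro sum_strict_mono_ex1)
    show "\<exists>i\<in>S. card (g \<inter> V i) < 1" using le[OF k] neq k by (meson order_le_neq_trans)
  qed (use S(1) le in auto)
  finally show False using cg by simp
qed

text \<open>Each transversal is the image of \<open>S\<close> under a choice function from
  \<open>PiE S V\<close>.\<close>

lemma card_transversals_le:
  assumes S: "finite S" "\<And>i. i \<in> S \<Longrightarrow> finite (V i)" "disjoint_family_on V S"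
  shows "card (transversals S V) \<le> (\<Prod>i\<in>S. card (V i))"
proof -
  have "transversals S V \<subseteq> (\<lambda>x. x ` S) ` PiE S V"
  proof
    fix g assume g: "g \<in> transversals S V"
    then have sub: "g \<subseteq> (\<Union>i\<in>S. V i)"
      unfolding transversals_def partite_set_def by auto
    have "\<exists>v. g \<inter> V k = {v}" if "k \<in> S" for k
      using transversal_meets_class[OF S g that] by (auto simp: card_1_singleton_iff)
    then obtain x where x: "\<And>k. k \<in> S \<Longrightarrow> g \<inter> V k = {x k}" by metis
    have "g = restrict x S ` S" using sub x by auto blast
    moreover have "restrict x S \<in> PiE S V" using x by auto
    ultimately show "g \<in> (\<lambda>x. x ` S) ` PiE S V" by blast
  qed
  then have "card (transversals S V) \<le> card ((\<lambda>x. x ` S) ` PiE S V)"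
    using S by (intro card_mono) (auto intro!: finite_imageI finite_PiE)
  also have "\<dots> \<le> card (PiE S V)"
    using S by (intro card_image_le finite_PiE) auto
  finally show ?thesis using S by (simp add: card_PiE)
qed

section \<open>Edges and tuples of a balanced hypergraph\<close>

locale balanced_partite_hypergraph =
  fixes r :: nat and I :: "'i set" and V :: "'i \<Rightarrow> 'a set" and E :: "'a set set"
  assumes finite_I: "finite I" and card_I: "card I = Suc r"
    and partite: "partite_hypergraph r I V E"
    and balanced: "\<And>g. partite_set I V g \<Longrightarrow> card g = r - 1 \<Longrightarrow> strictly_balanced_degree I V E g"
begin

abbreviation "part j \<equiv> induced_edges E (\<Union>i\<in>I - {j}. V i)"

lemma finite_V: "i \<in> I \<Longrightarrow> finite (V i)"
  and disj_V: "disjoint_family_on V I"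
  using partite unfolding partite_hypergraph_def by auto

lemma disjD: "i \<in> I \<Longrightarrow> j \<in> I \<Longrightarrow> i \<noteq> j \<Longrightarrow> V i \<inter> V j = {}"
  using disj_V by (auto simp: disjoint_family_on_def)

lemma finite_transversals: "S \<subseteq> I \<Longrightarrow> finite (transversals S V)"
proof (rule finite_subset)
  show "transversals S V \<subseteq> Pow (\<Union>i\<in>S. V i)"
    unfolding transversals_def partite_set_def by auto
qed (use finite_I finite_V in \<open>auto intro: finite_subset\<close>)

text \<open>An edge has \<open>r\<close> vertices and \<open>I - {j}\<close> has \<open>r\<close>
  indices, so an edge avoiding \<open>V j\<close> is a full transversal of the other
  classes.\<close>

lemma part_iff:
  assumes "j \<in> I"
  shows "e \<in> part j \<longleftrightarrow> e \<in> E \<and> e \<in> transversals (I - {j}) V"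
  using partite assms finite_I card_I
  unfolding induced_edges_def transversals_def partite_hypergraph_def uniform_hypergraph_def
    partite_set_def
  by auto

lemma part_meets_class:
  assumes "j \<in> I" "e \<in> part j" "k \<in> I - {j}"
  shows "card (e \<inter> V k) = 1"
  using assms part_iff finite_I finite_V disj_V
  by (intro transversal_meets_class[of "I - {j}"]) (auto simp: disjoint_family_on_def)

lemma transversal_disjoint_class:
  assumes "g \<in> transversals S V" "S \<subseteq> I" "k \<in> I - S"
  shows "g \<inter> V k = {}"
proof -
  have "g \<subseteq> (\<Union>i\<in>S. V i)" using assms unfolding transversals_def partite_set_def by auto
  moreover have "(\<Union>i\<in>S. V i) \<inter> V k = {}" using assms(2,3) disjD by blast
  ultimately show ?thesis by blast
qed

lemma degree_balanced:
  assumes ij: "i \<in> I" "j \<in> I" "i \<noteq> j" and g: "g \<in> transversals (I - {i, j}) V"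
  shows "degree_into E (V i) g = degree_into E (V j) g"
proof -
  have dis: "V i \<inter> g = {}" "V j \<inter> g = {}"
    using transversal_disjoint_class[OF g] ij by blast+
  have "card (I - {i, j}) = r - 1"
    using ij card_I finite_I by (simp add: card_Diff_subset)
  moreover have "partite_set I V g"
    unfolding partite_set_def
  proof (intro conjI ballI)
    show "g \<subseteq> (\<Union>i\<in>I. V i)" using g unfolding transversals_def partite_set_def by auto
    fix k assume "k \<in> I"
    show "card (g \<inter> V k) \<le> 1"
    proof (cases "k \<in> {i, j}")
      case True
      then show ?thesis using dis by (auto simp: Int_commute)
    next
      case False
      then show ?thesis using \<open>k \<in> I\<close> g unfolding transversals_def partite_set_def by auto
    qed
  qed
  ultimately have "strictly_balanced_degree I V E g"
    using g by (intro balanced) (simp_all add: transversals_def)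
  then show ?thesis using ij dis unfolding strictly_balanced_degree_def by blast
qed

section \<open>Double counting over tuples that miss two classes\<close>

lemma part_diff_transversal:
  assumes ij: "i \<in> I" "j \<in> I" "i \<noteq> j" and e: "e \<in> part j"
  shows "e - V i \<in> transversals (I - {i, j}) V"
proof -
  have e': "e \<subseteq> (\<Union>k\<in>I - {j}. V k)" "card e = r" and cl: "\<And>k. k \<in> I \<Longrightarrow> card (e \<inter> V k) \<le> 1"
    using e partite
    unfolding induced_edges_def partite_hypergraph_def uniform_hypergraph_def partite_set_def
    by auto
  have fin: "finite e"
    by (rule finite_subset[OF e'(1)]) (use finite_I finite_V in auto)
  have "card (e - V i) = r - 1"
    using part_meets_class[OF ij(2) e, of i] ij e' fin by (simp add: card_Diff_subset_Int)
  moreover have "card (I - {i, j}) = r - 1"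
    using ij card_I finite_I by (simp add: card_Diff_subset)
  moreover have "partite_set (I - {i, j}) V (e - V i)"
    unfolding partite_set_def
  proof (intro conjI ballI)
    show "e - V i \<subseteq> (\<Union>k\<in>I - {i, j}. V k)" using e' by auto
    fix k assume k: "k \<in> I - {i, j}"
    have "card ((e - V i) \<inter> V k) \<le> card (e \<inter> V k)"
      using fin by (intro card_mono) auto
    then show "card ((e - V i) \<inter> V k) \<le> 1" using cl[of k] k by auto
  qed
  ultimately show ?thesis unfolding transversals_def by simp
qed

text \<open>An edge avoiding \<open>V j\<close> splits uniquely into a tuple \<open>g\<close>
  missing \<open>V i\<close> and \<open>V j\<close> and a vertex of \<open>V i\<close> extending
  \<open>g\<close>. The weight \<open>f\<close> is free: the constant 1 counts edges, and the degree
  into \<open>V j\<close> yields the sum of squares.\<close>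

lemma sum_part:
  fixes f :: "'a set \<Rightarrow> nat"
  assumes ij: "i \<in> I" "j \<in> I" "i \<noteq> j"
  shows "(\<Sum>e\<in>part j. f (e - V i))
    = (\<Sum>g\<in>transversals (I - {i, j}) V. degree_into E (V i) g * f g)"
proof -
  let ?G = "transversals (I - {i, j}) V"
  let ?N = "\<lambda>g. {v \<in> V i. g \<union> {v} \<in> E}"
  have G: "g \<inter> V i = {}" "g \<subseteq> (\<Union>k\<in>I - {j}. V k)" if "g \<in> ?G" for g
    using transversal_disjoint_class[OF that, of i] that ij
    unfolding transversals_def partite_set_def by blast+
  have diff: "g - V i = g" if "g \<in> ?G" for g
    using G(1)[OF that] by (rule Diff_triv)
  have bij: "bij_betw (\<lambda>(g, v). insert v g) (Sigma ?G ?N) (part j)"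
    unfolding bij_betw_def
  proof
    show "inj_on (\<lambda>(g, v). insert v g) (Sigma ?G ?N)"
      \<comment> \<open>As \<open>g\<close> misses \<open>V i\<close>, the set
        \<open>insert v g\<close> determines \<open>g\<close> as its part outside \<open>V i\<close>
        and \<open>v\<close> as its only vertex inside.\<close>
      by (rule inj_on_inverseI[where g = "\<lambda>e. (e - V i, the_elem (e \<inter> V i))"])
        (clarsimp simp: G(1) diff)
    show "(\<lambda>(g, v). insert v g) ` Sigma ?G ?N = part j"
    proof
      show "(\<lambda>(g, v). insert v g) ` Sigma ?G ?N \<subseteq> part j"
        using ij G(2) unfolding induced_edges_def by fastforce
      show "part j \<subseteq> (\<lambda>(g, v). insert v g) ` Sigma ?G ?N"
      proof
        fix e assume e: "e \<in> part j"
        then obtain v where v: "e \<inter> V i = {v}"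
          using part_meets_class[OF ij(2) e, of i] ij by (auto simp: card_1_singleton_iff)
        then have "insert v (e - V i) = e" by auto
        moreover have "e \<in> E" using e unfolding induced_edges_def by auto
        ultimately show "e \<in> (\<lambda>(g, v). insert v g) ` Sigma ?G ?N"
          using part_diff_transversal[OF ij e] v by (intro image_eqI[of _ _ "(e - V i, v)"]) auto
      qed
    qed
  qed
  have "(\<Sum>e\<in>part j. f (e - V i)) = (\<Sum>(g, v)\<in>Sigma ?G ?N. f (insert v g - V i))"
    by (subst sum.reindex_bij_betw[OF bij, symmetric]) (simp add: case_prod_beta)
  also have "\<dots> = (\<Sum>(g, v)\<in>Sigma ?G ?N. f g)"
    by (intro sum.cong) (auto simp: diff)
  also have "\<dots> = (\<Sum>g\<in>?G. \<Sum>v\<in>?N g. f g)"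
    using finite_transversals[of "I - {i, j}"] finite_V[OF ij(1)]
    by (subst sum.Sigma) auto
  also have "\<dots> = (\<Sum>g\<in>?G. degree_into E (V i) g * f g)"
    unfolding degree_into_def by simp
  finally show ?thesis .
qed

lemma card_part:
  assumes "i \<in> I" "j \<in> I" "i \<noteq> j"
  shows "card (part j) = (\<Sum>g\<in>transversals (I - {i, j}) V. degree_into E (V i) g)"
  using sum_part[OF assms, of "\<lambda>_. 1"] by simp

text \<open>Both edge counts are degree sums over the same tuples, one into \<open>V j\<close> and
  one into \<open>V i\<close>; balance makes them agree term by term.\<close>

lemma card_part_eq:
  assumes "i \<in> I" "j \<in> I"
  shows "card (part i) = card (part j)"
proof (cases "i = j")
  case False
  have "card (part i) = (\<Sum>g\<in>transversals (I - {i, j}) V. degree_into E (V j) g)"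
    using card_part[of j i] assms False by (simp add: insert_commute)
  also have "\<dots> = card (part j)"
    using card_part[of i j] degree_balanced assms False by simp
  finally show ?thesis .
qed simp

text \<open>This is Cauchy-Schwarz for the degrees of the tuples missing \<open>V i\<close> and
  \<open>V j\<close>, multiplied out to avoid division by the sizes of classes.\<close>

lemma sum_degree_ge:
  assumes ij: "i \<in> I" "j \<in> I" "i \<noteq> j"
  shows "(card (part j))\<^sup>2
    \<le> (\<Prod>k\<in>I - {i, j}. card (V k)) * (\<Sum>e\<in>part j. degree_into E (V j) (e - V i))"
proof -
  let ?G = "transversals (I - {i, j}) V" and ?d = "degree_into E (V i)"
  have "(\<Sum>g\<in>?G. real (?d g))\<^sup>2 \<le> (\<Sum>g\<in>?G. (real (?d g))\<^sup>2) * card ?G"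
    by (rule sum_squared_le_sum_of_squares)
  then have "real ((\<Sum>g\<in>?G. ?d g)\<^sup>2) \<le> real (card ?G * (\<Sum>g\<in>?G. (?d g)\<^sup>2))"
    by (simp add: mult.commute)
  then have "(card (part j))\<^sup>2 \<le> card ?G * (\<Sum>g\<in>?G. (?d g)\<^sup>2)"
    unfolding card_part[OF ij] by (rule of_nat_le_iff[THEN iffD1])
  also have "\<dots> \<le> (\<Prod>k\<in>I - {i, j}. card (V k)) * (\<Sum>g\<in>?G. (?d g)\<^sup>2)"
    using finite_I finite_V disj_V
    by (intro mult_le_mono1 card_transversals_le) (auto simp: disjoint_family_on_def)
  \<comment> \<open>Balance turns one factor of each square into the degree into
    \<open>V j\<close>.\<close>
  also have "(\<Sum>g\<in>?G. (?d g)\<^sup>2) = (\<Sum>e\<in>part j. degree_into E (V j) (e - V i))"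
    using sum_part[OF ij] degree_balanced[OF ij] by (simp add: power2_eq_square)
  finally show ?thesis .
qed

text \<open>The copy has vertex set \<open>e\<close> together with \<open>w\<close>: its edge
  without \<open>w\<close> is \<open>e\<close>, and its edges through \<open>w\<close> are given by
  \<open>ext\<close>.\<close>

lemma complete_copy:
  assumes j: "j \<in> I" and e: "e \<in> part j" and w: "w \<in> V j"
    and ext: "\<And>i. i \<in> I - {j} \<Longrightarrow> (e - V i) \<union> {w} \<in> E"
  shows "contains_copy (\<Union>i\<in>I. V i) E I (complete_edges r I)"
proof -
  have "\<exists>v. e \<inter> V k = {v}" if "k \<in> I - {j}" for k
    using part_meets_class[OF j e that] by (auto simp: card_1_singleton_iff)
  then obtain x where x: "\<And>k. k \<in> I - {j} \<Longrightarrow> e \<inter> V k = {x k}" by metis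
  define f where "f = x(j := w)"
  then have f_j: "f j = w" by simp
  have f: "f k \<in> V k" if "k \<in> I" for k
    using x[of k] that w by (auto simp: f_def)
  have e_sub: "e \<in> E" "e \<subseteq> (\<Union>k\<in>I - {j}. V k)" using e unfolding induced_edges_def by auto
  \<comment> \<open>The case \<open>i = j\<close> describes \<open>e\<close> itself, since
    \<open>e\<close> avoids \<open>V j\<close>.\<close>
  have e_eq: "e - V i = f ` (I - {j, i})" if "i = j \<or> i \<in> I" for i
  proof
    show "e - V i \<subseteq> f ` (I - {j, i})"
    proof
      fix u assume u: "u \<in> e - V i"
      then obtain k where k: "k \<in> I - {j}" "u \<in> V k" using e_sub by auto
      then have "u = f k" using x[of k] u by (auto simp: f_def)
      then show "u \<in> f ` (I - {j, i})" using k u by auto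
    qed
    show "f ` (I - {j, i}) \<subseteq> e - V i"
    proof
      fix u assume "u \<in> f ` (I - {j, i})"
      then obtain k where k: "k \<in> I" "k \<noteq> j" "k \<noteq> i" "u = f k" by auto
      then have "u \<in> e" using x[of k] by (auto simp: f_def)
      moreover have "u \<notin> V i" using f[of k] k disjD[of k i] that j by blast
      ultimately show "u \<in> e - V i" by simp
    qed
  qed
  have "inj_on f I" using f disjD by (intro inj_onI) (metis disjoint_iff)
  moreover have "f ` I \<subseteq> (\<Union>i\<in>I. V i)" using f by auto
  moreover have "f ` a \<in> E" if "a \<in> complete_edges r I" for a
  proof -
    have a: "a \<subseteq> I" "card a = r" using that unfolding complete_edges_def by auto
    \<comment> \<open>An edge of the complete hypergraph omits exactly one of the
      \<open>r + 1\<close> indices.\<close>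
    then have "card (I - a) = 1" using card_I finite_I by (simp add: card_Diff_subset finite_subset)
    then obtain i where "I - a = {i}" by (auto simp: card_1_singleton_iff)
    then have i: "i \<in> I" "a = I - {i}" using a by auto
    show ?thesis
    proof (cases "i = j")
      case True
      have "e \<inter> V j = {}"
        using transversal_disjoint_class[of e "I - {j}" j] part_iff[OF j] e j by auto
      then have "f ` a = e" using e_eq[of j] True i by auto
      then show ?thesis using e_sub by simp
    next
      case False
      then have "a = insert j (I - {j, i})" using i j by auto
      then have "f ` a = (e - V i) \<union> {w}" using e_eq[of i] i f_j by simp
      then show ?thesis using ext i False by simp
    qed
  qed
  ultimately show ?thesis unfolding contains_copy_def by blast
qed

text \<open>A vertex of \<open>V j\<close> extending all \<open>r\<close> tuples
  \<open>e - V i\<close> would complete a copy, so each extends at most \<open>r - 1\<close>. Pairs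
  of an index and an extending vertex are then counted in two ways.\<close>

lemma sum_degree_le:
  assumes nc: "\<not> contains_copy (\<Union>i\<in>I. V i) E I (complete_edges r I)"
    and j: "j \<in> I" and e: "e \<in> part j"
  shows "(\<Sum>i\<in>I - {j}. degree_into E (V j) (e - V i)) \<le> (r - 1) * card (V j)"
proof -
  let ?A = "\<lambda>w. {i \<in> I - {j}. (e - V i) \<union> {w} \<in> E}"
  have card_A: "card (?A w) \<le> r - 1" if "w \<in> V j" for w
  proof -
    have "?A w \<subset> I - {j}" using complete_copy[OF j e that] nc by blast
    then have "card (?A w) < card (I - {j})" using finite_I by (intro psubset_card_mono) auto
    then show ?thesis using card_I finite_I j by simp
  qed
  have "(\<Sum>i\<in>I - {j}. degree_into E (V j) (e - V i)) = (\<Sum>w\<in>V j. card (?A w))"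
    unfolding degree_into_def
    using sum_multicount_gen[of "I - {j}" "V j" "\<lambda>i w. (e - V i) \<union> {w} \<in> E"
        "\<lambda>w. card (?A w)"] finite_I finite_V[OF j] by simp
  also have "\<dots> \<le> (\<Sum>w\<in>V j. r - 1)" using card_A by (intro sum_mono)
  finally show ?thesis by (simp add: mult.commute)
qed

section \<open>The bound on the densities\<close>

lemma sum_density_le:
  assumes nc: "\<not> contains_copy (\<Union>i\<in>I. V i) E I (complete_edges r I)"
    and r: "r \<ge> 1" and j: "j \<in> I"
  shows "(\<Sum>i\<in>I - {j}. class_density I V E i) \<le> real r - 1"
proof (cases "card (part j) = 0")
  \<comment> \<open>With no edges in one part there are none in any, so all densities
    vanish.\<close>
  case True
  then have "class_density I V E i = 0" if "i \<in> I" for i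
    unfolding class_density_def using card_part_eq[OF that j] by simp
  then show ?thesis using r by simp
next
  case False
  let ?m = "real (card (part j))" and ?n = "real (card (V j))"
  \<comment> \<open>Some other part \<open>part k\<close> also has an edge, and that edge meets
    \<open>V j\<close>. Hence \<open>?n\<close> is positive and can be cancelled at the end.\<close>
  have "card (I - {j}) \<noteq> 0" using card_I finite_I j r by simp
  then have "I - {j} \<noteq> {}" by (metis card.empty)
  then obtain k where k: "k \<in> I" "k \<noteq> j" by blast
  have "card (part k) \<noteq> 0" using card_part_eq[OF k(1) j] False by simp
  then obtain e where e: "e \<in> part k" by fastforce
  have "V j \<noteq> {}" using part_meets_class[OF k(1) e, of j] j k by auto
  then have n: "?n > 0" using finite_V[OF j] by (simp add: card_gt_0_iff)
  have density: "?m * ?n * class_density I V E i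
      \<le> (\<Sum>e\<in>part j. real (degree_into E (V j) (e - V i)))" if i: "i \<in> I - {j}" for i
  proof -
    let ?P = "\<Prod>k\<in>I - {i, j}. real (card (V k))"
    have "I - {i} = insert j (I - {i, j})" using i j by auto
    then have "(\<Prod>k\<in>I - {i}. real (card (V k))) = ?n * ?P"
      using finite_I by simp
    then have "?m * ?n * class_density I V E i = ?m\<^sup>2 / ?P"
      unfolding class_density_def using n card_part_eq[of i j] i j
      by (simp add: power2_eq_square)
    moreover have "real ((card (part j))\<^sup>2)
        \<le> real ((\<Prod>k\<in>I - {i, j}. card (V k)) * (\<Sum>e\<in>part j. degree_into E (V j) (e - V i)))"
      using sum_degree_ge[of i j] i j by (intro of_nat_mono) auto
    then have "?m\<^sup>2 \<le> ?P * (\<Sum>e\<in>part j. real (degree_into E (V j) (e - V i)))"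
      by simp
    moreover have "?P \<ge> 0" by (intro prod_nonneg) auto
    \<comment> \<open>If \<open>?P\<close> is 0, the quotient is 0 by convention and the right-hand
      side is nonnegative.\<close>
    ultimately show ?thesis
      by (cases "?P = 0") (auto simp: divide_le_eq mult.commute sum_nonneg)
  qed
  have "?m * ?n * (\<Sum>i\<in>I - {j}. class_density I V E i)
      \<le> (\<Sum>i\<in>I - {j}. \<Sum>e\<in>part j. real (degree_into E (V j) (e - V i)))"
    unfolding sum_distrib_left using density by (intro sum_mono)
  also have "\<dots> = (\<Sum>e\<in>part j. real (\<Sum>i\<in>I - {j}. degree_into E (V j) (e - V i)))"
    by (subst sum.swap) simp
  also have "\<dots> \<le> (\<Sum>e\<in>part j. real ((r - 1) * card (V j)))"
    using sum_degree_le[OF nc j] by (intro sum_mono of_nat_mono)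
  also have "\<dots> = ?m * ?n * (real r - 1)"
    using r by (simp add: of_nat_diff)
  finally show ?thesis using n False by simp
qed

end

theorem theorem3p4:
  fixes r :: nat and V :: "nat \<Rightarrow> 'a set" and E :: "'a set set"
  assumes "r \<ge> 2"
    and "partite_hypergraph r {1..r+1} V E"
    and "\<And>g. partite_set {1..r+1} V g \<Longrightarrow> card g = r - 1 \<Longrightarrow>
           strictly_balanced_degree {1..r+1} V E g"
    and "(MAX j\<in>{1..r+1}. \<Sum>i\<in>{1..r+1} - {j}. class_density {1..r+1} V E i) > real r - 1"
  shows "contains_copy (\<Union>i\<in>{1..r+1}. V i) E {1..r+1} (complete_edges r {1..r+1})"
proof (rule ccontr)
  assume nc: "\<not> ?thesis"
  interpret balanced_partite_hypergraph r "{1..r+1}" V E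
    using assms(2,3) by unfold_locales auto
  have "(MAX j\<in>{1..r+1}. \<Sum>i\<in>{1..r+1} - {j}. class_density {1..r+1} V E i) \<le> real r - 1"
    using sum_density_le[OF nc] assms(1) by (intro Max.boundedI) auto
  then show False using assms(4) by (meson not_le)
qed

end
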